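(* Let $C\in GL(\mathcal{H})$ and let $F:\Omega\to\mathcal{H}$ be a $C$-controlled continuous frame. Then $F$ is a continuous frame for $\mathcal{H}$ with respect to $(\Omega,\mu)$.
   Context: $\mathcal{H}$ is a complex Hilbert space with inner product linear in the first and conjugate linear in the second variable, and $(\Omega,\mu)$ is a measure space with positive measure $\mu$. $GL(\mathcal{H})$ is the set of bounded linear operators on $\mathcal{H}$ with bounded inverse. A mapping $F:\Omega\to\mathcal{H}$ is weakly measurable if $\omega\mapsto\langle f,F(\omega)\rangle$ is measurable for every $f\in\mathcal{H}$. A weakly measurable $F$ is a continuous frame for $\mathcal{H}$ with respect to $(\Omega,\mu)$ if there are constants $A,B>0$ with $A\|f\|^2\le\int_\Omega|\langle f,F(\omega)\rangle|^2\,d\mu(\omega)\le B\|f\|^2$ for all $f\in\mathcal{H}$. For $C\in GL(\mathcal{H})$, a $C$-controlled continuous frame is a weakly measurable map $F:\Omega\to\mathcal{H}$ for which there exist $m_{CL}>0$ and $M_{CL}<\infty$ such that, for all $f\in\mathcal{H}$, $m_{CL}\|f\|^2\le\int_\Omega\langle f,F(\omega)\rangle\langle CF(\omega),f\rangle\,d\mu(\omega)\le M_{CL}\|f\|^2$ (the integral being assumed to exist and be real). *)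

theory Defs
  imports "HOL-Analysis.Analysis"
begin

text \<open>
  Complex inner product spaces, with the inner product linear in the first and conjugate linear in
  the second argument. The underlying real normed structure is inherited from the library and is
  tied to the complex one by \<open>scaleR_scaleC\<close> and \<open>norm_eq_sqrt_cinner\<close>.
\<close>

class complex_inner = real_normed_vector +
  fixes scaleC :: "complex \<Rightarrow> 'a \<Rightarrow> 'a" (infixr "*\<^sub>C" 75)
    and cinner :: "'a \<Rightarrow> 'a \<Rightarrow> complex"
  assumes scaleC_add_right: "c *\<^sub>C (x + y) = c *\<^sub>C x + c *\<^sub>C y"
    and scaleC_add_left: "(c + d) *\<^sub>C x = c *\<^sub>C x + d *\<^sub>C x"
    and scaleC_scaleC: "c *\<^sub>C d *\<^sub>C x = (c * d) *\<^sub>C x"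
    and scaleC_one: "1 *\<^sub>C x = x"
    and scaleR_scaleC: "r *\<^sub>R x = complex_of_real r *\<^sub>C x"
    and cinner_commute: "cinner x y = cnj (cinner y x)"
    and cinner_add_left: "cinner (x + y) z = cinner x z + cinner y z"
    and cinner_scaleC_left: "cinner (c *\<^sub>C x) y = c * cinner x y"
    and cinner_ge_zero: "0 \<le> Re (cinner x x)"
    and cinner_eq_zero_iff: "cinner x x = 0 \<longleftrightarrow> x = 0"
    and norm_eq_sqrt_cinner: "norm x = sqrt (Re (cinner x x))"

class chilbert_space = complex_inner + complete_space

instantiation complex :: chilbert_space
begin

definition scaleC_complex :: "complex \<Rightarrow> complex \<Rightarrow> complex"
  where "scaleC_complex c x = c * x"

definition cinner_complex :: "complex \<Rightarrow> complex \<Rightarrow> complex"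
  where "cinner_complex x y = x * cnj y"

instance
  by standard
    (auto simp: scaleC_complex_def cinner_complex_def algebra_simps scaleR_conv_of_real
      cmod_def power2_eq_square)

end

definition bounded_clinear :: "('h::complex_inner \<Rightarrow> 'h) \<Rightarrow> bool"
  where "bounded_clinear T \<longleftrightarrow> bounded_linear T \<and> (\<forall>c x. T (c *\<^sub>C x) = c *\<^sub>C T x)"

definition GL :: "('h::chilbert_space \<Rightarrow> 'h) set"
  where "GL = {T. bounded_clinear T \<and>
    (\<exists>S. bounded_clinear S \<and> (\<forall>x. S (T x) = x) \<and> (\<forall>x. T (S x) = x))}"

definition weakly_measurable :: "'w measure \<Rightarrow> ('w \<Rightarrow> 'h::chilbert_space) \<Rightarrow> bool"
  where "weakly_measurable \<mu> F \<longleftrightarrow> (\<forall>f. (\<lambda>\<omega>. cinner f (F \<omega>)) \<in> borel_measurable \<mu>)"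

text \<open>
  The integral of the nonnegative function is taken in \<open>[0, \<infinity>]\<close>, so its finiteness is part of
  the upper frame bound and not assumed separately.
\<close>

definition continuous_frame :: "'w measure \<Rightarrow> ('w \<Rightarrow> 'h::chilbert_space) \<Rightarrow> bool"
  where "continuous_frame \<mu> F \<longleftrightarrow> weakly_measurable \<mu> F \<and>
    (\<exists>A B :: real. 0 < A \<and> 0 < B \<and>
      (\<forall>f. ennreal (A * (norm f)\<^sup>2) \<le> (\<integral>\<^sup>+ \<omega>. ennreal ((cmod (cinner f (F \<omega>)))\<^sup>2) \<partial>\<mu>) \<and>
           (\<integral>\<^sup>+ \<omega>. ennreal ((cmod (cinner f (F \<omega>)))\<^sup>2) \<partial>\<mu>) \<le> ennreal (B * (norm f)\<^sup>2)))"

text \<open>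
  Existence of the complex-valued integral is Lebesgue (Bochner) integrability. Once the integral
  is known to be real, it is compared with the bounds through its real part.
\<close>

definition controlled_continuous_frame ::
    "'w measure \<Rightarrow> ('h::chilbert_space \<Rightarrow> 'h) \<Rightarrow> ('w \<Rightarrow> 'h) \<Rightarrow> bool"
  where "controlled_continuous_frame \<mu> C F \<longleftrightarrow> weakly_measurable \<mu> F \<and>
    (\<exists>m M :: real. 0 < m \<and>
      (\<forall>f. integrable \<mu> (\<lambda>\<omega>. cinner f (F \<omega>) * cinner (C (F \<omega>)) f) \<and>
           (\<integral>\<omega>. cinner f (F \<omega>) * cinner (C (F \<omega>)) f \<partial>\<mu>) \<in> \<real> \<and>
           m * (norm f)\<^sup>2 \<le> Re (\<integral>\<omega>. cinner f (F \<omega>) * cinner (C (F \<omega>)) f \<partial>\<mu>) \<and>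
           Re (\<integral>\<omega>. cinner f (F \<omega>) * cinner (C (F \<omega>)) f \<partial>\<mu>) \<le> M * (norm f)\<^sup>2))"

end

theory Submission
  imports Defs
begin

text \<open>
  Write \<open>s f g = \<integral> \<langle>f, F\<rangle> \<langle>C F, g\<rangle>\<close>. The hypothesis speaks only of the diagonal \<open>s f f\<close>, but the
  integrand is sesquilinear in \<open>(f, g)\<close>, so polarization makes it integrable for all \<open>f\<close> and \<open>g\<close>, and
  together with the parallelogram law it turns the diagonal bound into
  \<open>\<bar>s f g\<bar> \<le> \<bar>M\<bar> (\<parallel>f\<parallel>\<^sup>2 + \<parallel>g\<parallel>\<^sup>2)\<close> (lemma \<open>polarized_integral\<close>).

  Since \<open>C\<close> is invertible, the second argument can absorb it: if \<open>g\<close> is the adjoint of the inverse of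
  \<open>C\<close> applied to \<open>f\<close>, then \<open>\<langle>C F, g\<rangle> = \<langle>F, f\<rangle>\<close> and the integrand becomes \<open>\<bar>\<langle>f, F\<rangle>\<bar>\<^sup>2\<close>. This gives the
  square integrability of \<open>\<langle>f, F\<rangle>\<close> and the upper frame bound at once
  (lemma \<open>frame_upper_bound\<close>).

  For the lower bound, the adjoint \<open>D\<close> of \<open>C\<close> gives \<open>m \<parallel>f\<parallel>\<^sup>2 \<le> \<integral> \<bar>\<langle>f, F\<rangle>\<bar> \<bar>\<langle>D f, F\<rangle>\<bar>\<close>. A weighted
  inequality between arithmetic and geometric mean splits the product; the upper bound applied to
  \<open>D f\<close> controls the second part, and with a suitable weight that part is half of the left-hand
  side and can be absorbed (lemma \<open>frame_lower_bound\<close>).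

  The last two steps need adjoints of bounded operators (lemma \<open>bounded_clinear_adjoint\<close>), hence the
  Riesz representation theorem, which is obtained by minimizing \<open>\<parallel>x\<parallel>\<^sup>2 - 2 Re (\<phi> x)\<close>.
\<close>

section \<open>Complex inner products\<close>

lemma cinner_add_right: "cinner x (y + z) = cinner x y + cinner x z"
  for x :: "'a::complex_inner"
  by (metis cinner_add_left cinner_commute complex_cnj_add)

lemma cinner_scaleC_right: "cinner x (c *\<^sub>C y) = cnj c * cinner x y"
  for x :: "'a::complex_inner"
  by (metis cinner_scaleC_left cinner_commute complex_cnj_mult)

lemma minus_eq_scaleC: "- x = (- 1) *\<^sub>C x"
  for x :: "'a::complex_inner"
  using scaleR_scaleC[of "- 1" x] by simp

lemma cinner_minus_left: "cinner (- x) y = - cinner x y"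
  for x :: "'a::complex_inner"
  by (simp add: minus_eq_scaleC[of x] cinner_scaleC_left)

lemma cinner_minus_right: "cinner x (- y) = - cinner x y"
  for x :: "'a::complex_inner"
  by (simp add: minus_eq_scaleC[of y] cinner_scaleC_right)

lemma cmod_cinner_commute: "cmod (cinner x y) = cmod (cinner y x)"
  for x :: "'a::complex_inner"
  by (metis cinner_commute complex_mod_cnj)

lemma cinner_diff_left: "cinner (x - y) z = cinner x z - cinner y z"
  for x :: "'a::complex_inner"
  using cinner_add_left[of x "- y" z] by (simp add: cinner_minus_left)

lemma cinner_diff_right: "cinner x (y - z) = cinner x y - cinner x z"
  for x :: "'a::complex_inner"
  using cinner_add_right[of x y "- z"] by (simp add: cinner_minus_right)

lemma power2_norm_eq_Re_cinner: "(norm x)\<^sup>2 = Re (cinner x x)"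
  for x :: "'a::complex_inner"
  by (simp add: norm_eq_sqrt_cinner cinner_ge_zero)

lemma cinner_self: "cinner x x = complex_of_real ((norm x)\<^sup>2)"
  for x :: "'a::complex_inner"
proof (rule complex_eqI)
  have "Im (cinner x x) = - Im (cinner x x)"
    by (metis cinner_commute cnj.sel(2))
  then show "Im (cinner x x) = Im (complex_of_real ((norm x)\<^sup>2))" by simp
qed (simp only: power2_norm_eq_Re_cinner Re_complex_of_real)

lemma norm_scaleC: "norm (c *\<^sub>C x) = cmod c * norm x"
  for x :: "'a::complex_inner"
proof -
  have "cinner (c *\<^sub>C x) (c *\<^sub>C x) = (c * cnj c) * complex_of_real ((norm x)\<^sup>2)"
    by (simp only: cinner_scaleC_left cinner_scaleC_right cinner_self[of x] mult_ac)
  also have "c * cnj c = complex_of_real ((cmod c)\<^sup>2)"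
    by (rule complex_norm_square[symmetric])
  finally have "(norm (c *\<^sub>C x))\<^sup>2 = (cmod c * norm x)\<^sup>2"
    by (simp add: power2_norm_eq_Re_cinner[of "c *\<^sub>C x"] power_mult_distrib
        flip: of_real_mult of_real_power)
  then show ?thesis by (simp add: power2_eq_iff_nonneg)
qed

lemma power2_norm_add: "(norm (x + y))\<^sup>2 = (norm x)\<^sup>2 + (norm y)\<^sup>2 + 2 * Re (cinner x y)"
  for x :: "'a::complex_inner"
proof -
  have "Re (cinner y x) = Re (cinner x y)" by (metis cinner_commute cnj.sel(1))
  then show ?thesis
    by (simp add: power2_norm_eq_Re_cinner cinner_add_left cinner_add_right)
qed

lemma parallelogram_law:
  "(norm (x + y))\<^sup>2 + (norm (x - y))\<^sup>2 = 2 * (norm x)\<^sup>2 + 2 * (norm y)\<^sup>2"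
  for x :: "'a::complex_inner"
  using power2_norm_add[of x y] power2_norm_add[of x "- y"]
  by (simp add: cinner_minus_right)

lemma cmod_cinner_le: "cmod (cinner x y) \<le> norm x * norm y"
  for x :: "'a::complex_inner"
proof (cases "y = 0")
  case True
  then show ?thesis using cinner_minus_right[of x 0] by simp
next
  case False
  define n where "n = (norm y)\<^sup>2"
  have n: "0 < n" using False by (simp add: n_def)
  define c where "c = - cinner x y / complex_of_real n"
  \<comment> \<open>With this \<open>c\<close> the vector \<open>x + c y\<close> is the component of \<open>x\<close> orthogonal to \<open>y\<close>.\<close>
  have "cnj c * cinner x y = - complex_of_real ((cmod (cinner x y))\<^sup>2 / n)"
    by (simp add: c_def complex_norm_square mult.commute del: of_real_power)
  then have re: "Re (cinner x (c *\<^sub>C y)) = - (cmod (cinner x y))\<^sup>2 / n"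
    by (simp add: cinner_scaleC_right)
  have nc: "(norm (c *\<^sub>C y))\<^sup>2 = (cmod (cinner x y))\<^sup>2 / n"
    using n by (simp add: norm_scaleC c_def norm_divide power_mult_distrib power_divide
        flip: n_def) (simp add: power2_eq_square)
  have "0 \<le> (norm (x + c *\<^sub>C y))\<^sup>2" by simp
  also have "\<dots> = (norm x)\<^sup>2 - (cmod (cinner x y))\<^sup>2 / n"
    unfolding power2_norm_add re nc by simp
  finally have "(cmod (cinner x y))\<^sup>2 \<le> (norm x * norm y)\<^sup>2"
    using n by (simp add: field_simps power_mult_distrib n_def)
  then show ?thesis by (rule power2_le_imp_le) simp
qed

section \<open>Riesz representation and adjoints\<close>

text \<open>
  The functional \<open>J x = \<parallel>x\<parallel>\<^sup>2 - 2 Re (\<phi> x)\<close> is bounded below, and the parallelogram law bounds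
  \<open>\<parallel>u - v\<parallel>\<^sup>2\<close> by the amounts by which \<open>J u\<close> and \<open>J v\<close> exceed its infimum. Minimizing sequences are
  therefore Cauchy. At the limit the first variation of \<open>J\<close> vanishes, which says that the limit
  represents the real part of \<open>\<phi>\<close>; complex linearity recovers \<open>\<phi>\<close> itself.
\<close>

lemma riesz_representation:
  fixes \<phi> :: "'h::chilbert_space \<Rightarrow> complex"
  assumes "bounded_linear \<phi>" and scale: "\<And>c x. \<phi> (c *\<^sub>C x) = c * \<phi> x"
  obtains y where "\<And>x. \<phi> x = cinner x y"
proof -
  interpret \<phi>: bounded_linear \<phi> by fact
  obtain K where K: "\<And>x. cmod (\<phi> x) \<le> norm x * K" using \<phi>.bounded by blast
  define J where "J = (\<lambda>x. (norm x)\<^sup>2 - 2 * Re (\<phi> x))"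
  have J_ge: "- K\<^sup>2 \<le> J x" for x
  proof -
    have "Re (\<phi> x) \<le> norm x * K" using K[of x] complex_Re_le_cmod[of "\<phi> x"] by linarith
    moreover have "0 \<le> (norm x - K)\<^sup>2" by simp
    ultimately show ?thesis unfolding J_def power2_diff by linarith
  qed
  define d where "d = Inf (range J)"
  have bdd: "bdd_below (range J)" using J_ge by (intro bdd_belowI[of _ "- K\<^sup>2"]) auto
  have d_le: "d \<le> J x" for x unfolding d_def by (rule cInf_lower) (use bdd in auto)
  have "\<exists>x. J x < d + inverse (real (Suc n))" for n
    using cInf_lessD[of "range J" "d + inverse (real (Suc n))"] by (auto simp: d_def)
  then obtain X where X: "\<And>n. J (X n) < d + inverse (real (Suc n))" by metis
  have dist: "(norm (u - v))\<^sup>2 \<le> 2 * (J u - d) + 2 * (J v - d)" for u v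
  proof -
    have "(norm ((1/2) *\<^sub>R (u + v)))\<^sup>2 = (norm (u + v))\<^sup>2 / 4"
      by (simp add: power_divide)
    moreover have "Re (\<phi> ((1/2) *\<^sub>R (u + v))) = (Re (\<phi> u) + Re (\<phi> v)) / 2"
      by (simp only: \<phi>.scaleR \<phi>.add) simp
    ultimately have "4 * J ((1/2) *\<^sub>R (u + v)) = (norm (u + v))\<^sup>2 - 4 * Re (\<phi> u) - 4 * Re (\<phi> v)"
      by (simp add: J_def)
    with d_le[of "(1/2) *\<^sub>R (u + v)"] parallelogram_law[of u v] show ?thesis
      by (simp add: J_def)
  qed
  have "Cauchy X"
  proof (rule metric_CauchyI)
    fix e :: real assume "0 < e"
    then obtain N where N: "inverse (real (Suc N)) < e\<^sup>2 / 4"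
      using reals_Archimedean[of "e\<^sup>2 / 4"] by auto
    have close: "J (X n) - d < e\<^sup>2 / 4" if "N \<le> n" for n
    proof -
      have "inverse (real (Suc n)) \<le> inverse (real (Suc N))"
        using that by (intro le_imp_inverse_le) auto
      with X[of n] N show ?thesis by linarith
    qed
    have "dist (X p) (X q) < e" if "N \<le> p" "N \<le> q" for p q
    proof -
      have "(norm (X p - X q))\<^sup>2 \<le> 2 * (J (X p) - d) + 2 * (J (X q) - d)" by (rule dist)
      also have "\<dots> < 2 * (e\<^sup>2 / 4) + 2 * (e\<^sup>2 / 4)"
        by (intro add_strict_mono mult_strict_left_mono close that) auto
      also have "\<dots> = e\<^sup>2" by simp
      finally have "(norm (X p - X q))\<^sup>2 < e\<^sup>2" .
      then show ?thesis
        using \<open>0 < e\<close> by (simp add: dist_norm power_less_imp_less_base)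
    qed
    then show "\<exists>N. \<forall>p\<ge>N. \<forall>q\<ge>N. dist (X p) (X q) < e" by blast
  qed
  then obtain y where y: "X \<longlonglongrightarrow> y" using Cauchy_convergent convergent_def by blast
  have "(\<lambda>n. J (X n)) \<longlonglongrightarrow> J y"
    unfolding J_def by (intro tendsto_intros \<phi>.tendsto y)
  moreover have "(\<lambda>n. d + inverse (real (Suc n))) \<longlonglongrightarrow> d + 0"
    by (intro tendsto_intros LIMSEQ_inverse_real_of_nat)
  ultimately have "J y \<le> d + 0" by (rule LIMSEQ_le) (use X less_imp_le in blast)
  then have min: "J y \<le> J x" for x using d_le[of x] by simp
  have Re_eq: "Re (\<phi> x) = Re (cinner x y)" for x
  proof -
    define r where "r = Re (cinner y x) - Re (\<phi> x)"
    define n where "n = (norm x)\<^sup>2"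
    have n: "0 \<le> n" by (simp add: n_def)
    have var: "0 \<le> 2 * t * r + t\<^sup>2 * n" for t
    proof -
      have "Re (cinner y (t *\<^sub>R x)) = t * Re (cinner y x)"
        by (simp add: scaleR_scaleC cinner_scaleC_right)
      then have "J (y + t *\<^sub>R x) = J y + 2 * t * r + t\<^sup>2 * n"
        unfolding J_def power2_norm_add \<phi>.add \<phi>.scaleR r_def n_def
        by (simp add: power_mult_distrib algebra_simps)
      then show ?thesis using min[of "y + t *\<^sub>R x"] by simp
    qed
    \<comment> \<open>A step against the sign of \<open>r\<close>, short enough that the linear term dominates.\<close>
    define t where "t = - r / (n + 1)"
    have r_eq: "r = - t * (n + 1)" using n by (simp add: t_def)
    have "0 \<le> - (t\<^sup>2 * (n + 2))"
      using var[of t] unfolding r_eq by (simp add: algebra_simps power2_eq_square)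
    then have "t\<^sup>2 * (n + 2) \<le> 0" by simp
    then have "t = 0" using n by (simp add: mult_le_0_iff)
    then have "r = 0" using r_eq by simp
    moreover have "Re (cinner y x) = Re (cinner x y)" by (metis cinner_commute cnj.sel(1))
    ultimately show ?thesis by (simp add: r_def)
  qed
  have "\<phi> x = cinner x y" for x
  proof (rule complex_eqI)
    show "Im (\<phi> x) = Im (cinner x y)"
      using Re_eq[of "\<i> *\<^sub>C x"] by (simp add: scale cinner_scaleC_left)
  qed (rule Re_eq)
  then show ?thesis by (rule that)
qed

lemma bounded_clinear_adjoint:
  fixes T :: "'h::chilbert_space \<Rightarrow> 'h"
  assumes "bounded_clinear T"
  obtains T' K where "\<And>x y. cinner (T x) y = cinner x (T' y)"
    and "0 < K" and "\<And>y. norm (T' y) \<le> K * norm y"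
proof -
  have bl: "bounded_linear T" and scale: "\<And>c x. T (c *\<^sub>C x) = c *\<^sub>C T x"
    using assms by (auto simp: bounded_clinear_def)
  obtain K where K: "0 < K" "\<And>x. norm (T x) \<le> norm x * K"
    using bounded_linear.pos_bounded[OF bl] by blast
  have "\<exists>z. \<forall>x. cinner (T x) y = cinner x z" for y
  proof -
    have "bounded_linear (\<lambda>x. cinner (T x) y)"
    proof (rule bounded_linear_intro[where K = "K * norm y"])
      fix x
      have "cmod (cinner (T x) y) \<le> norm (T x) * norm y" by (rule cmod_cinner_le)
      also have "\<dots> \<le> (norm x * K) * norm y" by (intro mult_right_mono K) simp
      finally show "cmod (cinner (T x) y) \<le> norm x * (K * norm y)" by (simp add: mult_ac)
    qed (auto simp: bounded_linear.linear[OF bl] linear_add linear_scale cinner_add_left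
          scaleR_scaleC scale cinner_scaleC_left scaleC_complex_def)
    then obtain z where "\<And>x. cinner (T x) y = cinner x z"
      by (rule riesz_representation) (auto simp: scale cinner_scaleC_left)
    then show ?thesis by blast
  qed
  then obtain T' where T': "\<And>x y. cinner (T x) y = cinner x (T' y)" by metis
  have "norm (T' y) \<le> K * norm y" for y
  proof -
    have "(norm (T' y))\<^sup>2 = Re (cinner (T (T' y)) y)"
      unfolding power2_norm_eq_Re_cinner T' ..
    also have "\<dots> \<le> norm (T (T' y)) * norm y"
      using complex_Re_le_cmod cmod_cinner_le order_trans by blast
    also have "\<dots> \<le> (norm (T' y) * K) * norm y" by (intro mult_right_mono K) simp
    finally have "norm (T' y) * norm (T' y) \<le> norm (T' y) * (K * norm y)"
      by (simp add: power2_eq_square mult_ac)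
    then show ?thesis using K(1)
      by (cases "norm (T' y) = 0") (auto simp: mult_le_cancel_left)
  qed
  with T' K(1) show ?thesis by (rule that)
qed

section \<open>Polarization of the frame integral\<close>

lemma cinner_polarization:
  fixes f g u v :: "'a::complex_inner"
  defines "q \<equiv> \<lambda>h. cinner h u * cinner v h"
  shows "cinner f u * cinner v g =
    (q (f + g) - q (f - g) + \<i> * q (f + \<i> *\<^sub>C g) - \<i> * q (f - \<i> *\<^sub>C g)) / 4"
  unfolding q_def
  by (simp add: cinner_add_left cinner_add_right cinner_diff_left cinner_diff_right
      cinner_scaleC_left cinner_scaleC_right algebra_simps)

text \<open>
  By the parallelogram law the squared norms of the four vectors in the polarization identity add up
  to \<open>4 (\<parallel>f\<parallel>\<^sup>2 + \<parallel>g\<parallel>\<^sup>2)\<close>, so the diagonal bound survives with the same constant.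
\<close>

lemma polarized_integral:
  fixes F G :: "'w \<Rightarrow> 'a::complex_inner"
  assumes int: "\<And>f. integrable \<mu> (\<lambda>\<omega>. cinner f (F \<omega>) * cinner (G \<omega>) f)"
    and bound: "\<And>f. cmod (\<integral>\<omega>. cinner f (F \<omega>) * cinner (G \<omega>) f \<partial>\<mu>) \<le> M * (norm f)\<^sup>2"
  shows "integrable \<mu> (\<lambda>\<omega>. cinner f (F \<omega>) * cinner (G \<omega>) g)"
    and "cmod (\<integral>\<omega>. cinner f (F \<omega>) * cinner (G \<omega>) g \<partial>\<mu>) \<le> M * ((norm f)\<^sup>2 + (norm g)\<^sup>2)"
proof -
  define q where "q = (\<lambda>h \<omega>. cinner h (F \<omega>) * cinner (G \<omega>) h)"
  have int_q: "integrable \<mu> (q h)" for h using int by (simp add: q_def)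
  have pol: "(\<lambda>\<omega>. cinner f (F \<omega>) * cinner (G \<omega>) g) =
    (\<lambda>\<omega>. (q (f + g) \<omega> - q (f - g) \<omega> + \<i> * q (f + \<i> *\<^sub>C g) \<omega> - \<i> * q (f - \<i> *\<^sub>C g) \<omega>) / 4)"
    unfolding q_def by (rule ext) (rule cinner_polarization)
  show "integrable \<mu> (\<lambda>\<omega>. cinner f (F \<omega>) * cinner (G \<omega>) g)"
    unfolding pol by (intro integrable_divide Bochner_Integration.integrable_add
        Bochner_Integration.integrable_diff integrable_mult_right int_q)
  define Q where "Q = (\<lambda>h. \<integral>\<omega>. q h \<omega> \<partial>\<mu>)"
  have Q: "cmod (Q h) \<le> M * (norm h)\<^sup>2" for h using bound by (simp add: Q_def q_def)
  have "(\<integral>\<omega>. cinner f (F \<omega>) * cinner (G \<omega>) g \<partial>\<mu>) =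
      (Q (f + g) - Q (f - g) + \<i> * Q (f + \<i> *\<^sub>C g) - \<i> * Q (f - \<i> *\<^sub>C g)) / 4"
    unfolding pol Q_def by (simp add: int_q)
  also have "cmod \<dots> \<le>
      (cmod (Q (f + g)) + cmod (Q (f - g)) + cmod (Q (f + \<i> *\<^sub>C g)) + cmod (Q (f - \<i> *\<^sub>C g))) / 4"
  proof -
    have "cmod (a - b + \<i> * c - \<i> * e) \<le> cmod a + cmod b + cmod c + cmod e" for a b c e
      using norm_triangle_ineq4[of "a - b + \<i> * c" "\<i> * e"]
        norm_triangle_ineq[of "a - b" "\<i> * c"] norm_triangle_ineq4[of a b]
      by (simp add: norm_mult)
    then show ?thesis by (simp add: norm_divide)
  qed
  also have "\<dots> \<le> M * (((norm (f + g))\<^sup>2 + (norm (f - g))\<^sup>2)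
      + ((norm (f + \<i> *\<^sub>C g))\<^sup>2 + (norm (f - \<i> *\<^sub>C g))\<^sup>2)) / 4"
    using Q[of "f + g"] Q[of "f - g"] Q[of "f + \<i> *\<^sub>C g"] Q[of "f - \<i> *\<^sub>C g"]
    by (simp add: distrib_left)
  also have "\<dots> = M * ((norm f)\<^sup>2 + (norm g)\<^sup>2)"
    unfolding parallelogram_law by (simp add: norm_scaleC algebra_simps)
  finally show "cmod (\<integral>\<omega>. cinner f (F \<omega>) * cinner (G \<omega>) g \<partial>\<mu>) \<le> M * ((norm f)\<^sup>2 + (norm g)\<^sup>2)" .
qed

section \<open>The frame bounds\<close>

text \<open>
  The value \<open>g = S' f\<close>, with \<open>S'\<close> the adjoint of the inverse of \<open>C\<close>, makes the polarized integrand equal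
  to \<open>\<bar>\<langle>f, F\<rangle>\<bar>\<^sup>2\<close>. Square integrability of \<open>\<langle>f, F\<rangle>\<close> is thus a conclusion here, and the constant
  is uniform in \<open>f\<close> because \<open>S'\<close> is bounded.
\<close>

lemma frame_upper_bound:
  fixes F :: "'w \<Rightarrow> 'h::chilbert_space"
  assumes "C \<in> GL"
    and "\<And>f. integrable \<mu> (\<lambda>\<omega>. cinner f (F \<omega>) * cinner (C (F \<omega>)) f)"
    and "\<And>f. cmod (\<integral>\<omega>. cinner f (F \<omega>) * cinner (C (F \<omega>)) f \<partial>\<mu>) \<le> M * (norm f)\<^sup>2"
    and "0 \<le> M"
  obtains B where "0 < B" and "\<And>f. integrable \<mu> (\<lambda>\<omega>. (cmod (cinner f (F \<omega>)))\<^sup>2)"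
    and "\<And>f. (\<integral>\<omega>. (cmod (cinner f (F \<omega>)))\<^sup>2 \<partial>\<mu>) \<le> B * (norm f)\<^sup>2"
proof -
  note polarized = polarized_integral[where G = "\<lambda>\<omega>. C (F \<omega>)", OF assms(2,3)]
  obtain S where S: "bounded_clinear S" "\<And>x. S (C x) = x" using assms(1) by (auto simp: GL_def)
  obtain S' L where S': "\<And>x y. cinner (S x) y = cinner x (S' y)"
    and L: "0 < L" "\<And>y. norm (S' y) \<le> L * norm y"
    using bounded_clinear_adjoint[OF S(1)] by blast
  have absorb: "cinner f (F \<omega>) * cinner (C (F \<omega>)) (S' f)
      = complex_of_real ((cmod (cinner f (F \<omega>)))\<^sup>2)" for f \<omega>
  proof -
    have "cinner (C (F \<omega>)) (S' f) = cnj (cinner f (F \<omega>))"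
      by (metis S' S(2) cinner_commute)
    then show ?thesis by (simp add: complex_norm_square del: of_real_power)
  qed
  have int: "integrable \<mu> (\<lambda>\<omega>. (cmod (cinner f (F \<omega>)))\<^sup>2)" for f
    using polarized(1)[of f "S' f"] unfolding absorb by (simp only: complex_of_real_integrable_eq)
  show ?thesis
  proof (rule that)
    show "0 < M * (1 + L\<^sup>2) + 1" using assms(4) by (intro add_nonneg_pos mult_nonneg_nonneg) auto
  next
    fix f
    show "integrable \<mu> (\<lambda>\<omega>. (cmod (cinner f (F \<omega>)))\<^sup>2)" by (rule int)
    have "(\<integral>\<omega>. (cmod (cinner f (F \<omega>)))\<^sup>2 \<partial>\<mu>)
        \<le> cmod (\<integral>\<omega>. complex_of_real ((cmod (cinner f (F \<omega>)))\<^sup>2) \<partial>\<mu>)"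
      unfolding integral_complex_of_real norm_of_real by (rule abs_ge_self)
    also have "\<dots> \<le> M * ((norm f)\<^sup>2 + (norm (S' f))\<^sup>2)"
      using polarized(2)[of f "S' f"] unfolding absorb .
    also have "\<dots> \<le> M * ((norm f)\<^sup>2 + (L * norm f)\<^sup>2)"
      using assms(4) L(2)[of f] by (intro mult_left_mono add_left_mono power_mono) auto
    also have "\<dots> \<le> (M * (1 + L\<^sup>2) + 1) * (norm f)\<^sup>2"
      by (simp add: power_mult_distrib algebra_simps)
    finally show "(\<integral>\<omega>. (cmod (cinner f (F \<omega>)))\<^sup>2 \<partial>\<mu>) \<le> (M * (1 + L\<^sup>2) + 1) * (norm f)\<^sup>2" .
  qed
qed

text \<open>
  Moving \<open>C\<close> to the other side as its adjoint \<open>D\<close> exhibits the integrand as a product of two square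
  integrable functions, of which \<open>\<langle>D f, F\<rangle>\<close> is already controlled by the upper frame bound; the
  lower estimate on the product must then come from \<open>\<langle>f, F\<rangle>\<close>.
\<close>

lemma frame_lower_bound:
  fixes F :: "'w \<Rightarrow> 'h::chilbert_space"
  assumes "bounded_clinear C" and "0 < m" and "0 < B"
    and int: "\<And>f. integrable \<mu> (\<lambda>\<omega>. (cmod (cinner f (F \<omega>)))\<^sup>2)"
    and upper: "\<And>f. (\<integral>\<omega>. (cmod (cinner f (F \<omega>)))\<^sup>2 \<partial>\<mu>) \<le> B * (norm f)\<^sup>2"
    and lower: "\<And>f. m * (norm f)\<^sup>2 \<le> cmod (\<integral>\<omega>. cinner f (F \<omega>) * cinner (C (F \<omega>)) f \<partial>\<mu>)"
  obtains A where "0 < A" and "\<And>f. A * (norm f)\<^sup>2 \<le> (\<integral>\<omega>. (cmod (cinner f (F \<omega>)))\<^sup>2 \<partial>\<mu>)"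
proof -
  obtain D K where D: "\<And>x y. cinner (C x) y = cinner x (D y)"
    and K: "0 < K" "\<And>y. norm (D y) \<le> K * norm y"
    using bounded_clinear_adjoint[OF assms(1)] by blast
  \<comment> \<open>With this weight the bound on the \<open>D f\<close> part is exactly half of \<open>m \<parallel>f\<parallel>\<^sup>2\<close>.\<close>
  define t where "t = B * K\<^sup>2 / m"
  have t: "0 < t" using assms(2,3) K(1) by (simp add: t_def)
  define I where "I f = (\<integral>\<omega>. (cmod (cinner f (F \<omega>)))\<^sup>2 \<partial>\<mu>)" for f
  have amgm: "a * b \<le> t / 2 * a\<^sup>2 + 1 / (2 * t) * b\<^sup>2" for a b :: real
  proof -
    have "0 \<le> (t * a - b)\<^sup>2 / (2 * t)" using t by simp
    also have "\<dots> = t / 2 * a\<^sup>2 + 1 / (2 * t) * b\<^sup>2 - a * b"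
      using t by (simp add: field_simps power2_eq_square)
    finally show ?thesis by simp
  qed
  show ?thesis
  proof (rule that)
    show "0 < m / t" using assms(2) t by simp
  next
    fix f
    have "m * (norm f)\<^sup>2 \<le> cmod (\<integral>\<omega>. cinner f (F \<omega>) * cinner (C (F \<omega>)) f \<partial>\<mu>)"
      by (rule lower)
    also have "\<dots> \<le> (\<integral>\<omega>. t / 2 * (cmod (cinner f (F \<omega>)))\<^sup>2
        + 1 / (2 * t) * (cmod (cinner (D f) (F \<omega>)))\<^sup>2 \<partial>\<mu>)"
    proof (rule order_trans[OF integral_norm_bound integral_mono'])
      show "integrable \<mu> (\<lambda>\<omega>. t / 2 * (cmod (cinner f (F \<omega>)))\<^sup>2
          + 1 / (2 * t) * (cmod (cinner (D f) (F \<omega>)))\<^sup>2)"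
        by (intro Bochner_Integration.integrable_add integrable_mult_right int)
    next
      fix \<omega>
      have "cmod (cinner (C (F \<omega>)) f) = cmod (cinner (D f) (F \<omega>))"
        by (metis D cmod_cinner_commute)
      then show "cmod (cinner f (F \<omega>) * cinner (C (F \<omega>)) f)
          \<le> t / 2 * (cmod (cinner f (F \<omega>)))\<^sup>2 + 1 / (2 * t) * (cmod (cinner (D f) (F \<omega>)))\<^sup>2"
        using amgm by (simp only: norm_mult)
    qed (use t in simp)
    also have "\<dots> = t / 2 * I f + 1 / (2 * t) * I (D f)"
      by (simp add: int I_def del: times_divide_eq_left)
    also have "\<dots> \<le> t / 2 * I f + 1 / (2 * t) * (B * (K * norm f)\<^sup>2)"
    proof -
      have "I (D f) \<le> B * (norm (D f))\<^sup>2" unfolding I_def by (rule upper)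
      also have "\<dots> \<le> B * (K * norm f)\<^sup>2"
        using assms(3) K(2) by (intro mult_left_mono power_mono) auto
      finally show ?thesis using t by (intro add_left_mono mult_left_mono) auto
    qed
    also have "1 / (2 * t) * (B * (K * norm f)\<^sup>2) = m / 2 * (norm f)\<^sup>2"
      using assms(2,3) K(1) by (simp add: t_def power_mult_distrib field_simps)
    finally have "m * (norm f)\<^sup>2 \<le> t * I f" by simp
    then show "m / t * (norm f)\<^sup>2 \<le> (\<integral>\<omega>. (cmod (cinner f (F \<omega>)))\<^sup>2 \<partial>\<mu>)"
      using t unfolding I_def[symmetric] by (simp add: field_simps)
  qed
qed

theorem proposition4p2:
  fixes \<mu> :: "'w measure"
    and C :: "'h::chilbert_space \<Rightarrow> 'h"
    and F :: "'w \<Rightarrow> 'h"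
  assumes "C \<in> GL"
    and "controlled_continuous_frame \<mu> C F"
  shows "continuous_frame \<mu> F"
proof -
  define Q where "Q = (\<lambda>f. \<integral>\<omega>. cinner f (F \<omega>) * cinner (C (F \<omega>)) f \<partial>\<mu>)"
  obtain m M where wm: "weakly_measurable \<mu> F" and m: "0 < m"
    and int: "\<And>f. integrable \<mu> (\<lambda>\<omega>. cinner f (F \<omega>) * cinner (C (F \<omega>)) f)"
    and real: "\<And>f. Q f \<in> \<real>"
    and low: "\<And>f. m * (norm f)\<^sup>2 \<le> Re (Q f)" and up: "\<And>f. Re (Q f) \<le> M * (norm f)\<^sup>2"
    using assms(2) unfolding controlled_continuous_frame_def Q_def by blast
  have C: "bounded_clinear C" using assms(1) by (simp add: GL_def)
  have cmod_Q: "cmod (Q f) = Re (Q f)" for f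
  proof -
    have "0 \<le> m * (norm f)\<^sup>2" using m by simp
    then have "0 \<le> Re (Q f)" using low[of f] by linarith
    then show ?thesis using real[of f] by (simp add: in_Reals_norm complex_is_Real_iff cmod_eq_Re)
  qed
  have bound: "cmod (Q f) \<le> \<bar>M\<bar> * (norm f)\<^sup>2" for f
    using up[of f] mult_right_mono[OF abs_ge_self[of M], of "(norm f)\<^sup>2"] by (simp add: cmod_Q)
  obtain B where B: "0 < B" "\<And>f. integrable \<mu> (\<lambda>\<omega>. (cmod (cinner f (F \<omega>)))\<^sup>2)"
    "\<And>f. (\<integral>\<omega>. (cmod (cinner f (F \<omega>)))\<^sup>2 \<partial>\<mu>) \<le> B * (norm f)\<^sup>2"
    by (rule frame_upper_bound[OF assms(1) int bound[unfolded Q_def] abs_ge_zero]) (rule that)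
  have "m * (norm f)\<^sup>2 \<le> cmod (Q f)" for f using low by (simp only: cmod_Q)
  then obtain A where A: "0 < A" "\<And>f. A * (norm f)\<^sup>2 \<le> (\<integral>\<omega>. (cmod (cinner f (F \<omega>)))\<^sup>2 \<partial>\<mu>)"
    unfolding Q_def by (rule frame_lower_bound[OF C m B]) (rule that)
  have "(\<integral>\<^sup>+ \<omega>. ennreal ((cmod (cinner f (F \<omega>)))\<^sup>2) \<partial>\<mu>)
      = ennreal (\<integral>\<omega>. (cmod (cinner f (F \<omega>)))\<^sup>2 \<partial>\<mu>)" for f
    by (rule nn_integral_eq_integral) (auto simp: B(2))
  then show ?thesis
    unfolding continuous_frame_def using wm A(1) B(1)
    by (intro conjI exI[of _ A] exI[of _ B] allI) (simp_all add: ennreal_leI A(2) B(3))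
qed

end
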